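(* Let $p,q,r$ be positive integers and let $\boldsymbol{k}=(k_1,\ldots,k_r)$ with all $k_j\in\mathbb{N}\setminus\{1\}$. Let $z_0,z_1,\ldots,z_{r+1}$ be meromorphic functions of $t$ with at most logarithmic singularities, and let $x>0$ be such that all integrals below converge absolutely. Then $$\begin{aligned} &\xi^{(x)}_{z_0}\left(\begin{array}{c}\{z_1\}_{q-1},z_1,\ldots,z_r\\ \{1\}_{q-1},k_1,\ldots,k_{r-1},k_r-1\end{array};\begin{array}{c}\{z_{r+1}\}_p\\ \{1\}_p\end{array}\right)\\ &\quad-(-1)^{|\boldsymbol{k}|}\,\xi^{(x)}_{z_0}\left(\begin{array}{c}\{z_{r+1}\}_{p},z_r,\ldots,z_2\\ \{1\}_{p-1},k_r,\ldots,k_2,k_1-1\end{array};\begin{array}{c}\{z_1\}_q\\ \{1\}_q\end{array}\right)\\ &=\sum_{j=0}^{r-1}(-1)^{|\overleftarrow{\boldsymbol{k}}_j|}\sum_{i=1}^{k_{r-j}-2}(-1)^{i-1}L_{z_0}\left(\begin{array}{c}\{z_{r+1}\}_p,\overleftarrow{\boldsymbol{z}}_j\\ \{1\}_{p-1},\overleftarrow{\boldsymbol{k}}_j,i+1\end{array};x\right)L_{z_0}\left(\begin{array}{c}\{z_1\}_{q-1},\overrightarrow{\boldsymbol{z}}_{r-j}\\ \{1\}_{q-1},\overrightarrow{\boldsymbol{k}}_{r-j-1},k_{r-j}-i\end{array};x\right)\\ &\quad+\sum_{j=0}^{r-2}(-1)^{|\overleftarrow{\boldsymbol{k}}_{j+1}|}\Bigg\{L_{z_0}\left(\begin{array}{c}\{z_{r+1}\}_p,\overleftarrow{\boldsymbol{z}}_j\\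 \{1\}_{p-1},\overleftarrow{\boldsymbol{k}}_{j+1}\end{array};x\right)L_{z_0}\left(\begin{array}{c}\{z_1\}_{q-1},\overrightarrow{\boldsymbol{z}}_{r-j}\\ \{1\}_{q-1},\overrightarrow{\boldsymbol{k}}_{r-j-1},1\end{array};x\right)\\ &\qquad\qquad-L_{z_0}\left(\begin{array}{c}\{z_{r+1}\}_p,\overleftarrow{\boldsymbol{z}}_{j+1}\\ \{1\}_{p-1},\overleftarrow{\boldsymbol{k}}_{j+1},1\end{array};x\right)L_{z_0}\left(\begin{array}{c}\{z_1\}_{q-1},\overrightarrow{\boldsymbol{z}}_{r-j-1}\\ \{1\}_{q-1},\overrightarrow{\boldsymbol{k}}_{r-j-1}\end{array};x\right)\Bigg\}. \end{aligned}$$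
   Context: $\mathbb{N}$ is the set of positive integers. $\{a\}_n$ means $a$ repeated $n$ times (nothing if $n=0$). "At most logarithmic singularities" means that the poles of the function are at most simple. Iterated integral: $\int_0^x f_1(t)dt\,f_2(t)dt\cdots f_n(t)dt:=\int_{0<t_1<\cdots<t_n<x}f_1(t_1)\cdots f_n(t_n)\,dt_1\cdots dt_n$. Formal multiple polylogarithm function: for functions $w_1,\ldots,w_d$ and positive integers $m_1,\ldots,m_d$, $$L_{z_0}\left(\begin{array}{c}w_1,\ldots,w_d\\ m_1,\ldots,m_d\end{array};x\right):=\int_0^x w_1(t)dt\,(z_0(t)dt)^{m_1-1}\cdots w_d(t)dt\,(z_0(t)dt)^{m_d-1},$$ where $(z_0(t)dt)^{m}$ denotes $m$ consecutive factors $z_0(t)dt$; for $d=0$ the value is $1$. General formal Arakawa–Kaneko zeta values: for a function $w$ and $p\ge 0$, $$\xi^{(x)}_{z_0}\left(\begin{array}{c}w_1,\ldots,w_d\\ m_1,\ldots,m_d\end{array};\begin{array}{c}\{w\}_p\\ \{1\}_p\end{array}\right):=\int_0^x L_{z_0}\left(\begin{array}{c}\{w\}_p\\ \{1\}_p\end{array};t\right)z_0(t)\,L_{z_0}\left(\begin{array}{c}w_1,\ldots,w_d\\ m_1,\ldots,m_d\end{array};t\right)dt.$$ Notation for $\boldsymbol{k}=(k_1,\ldots,k_r)$ and $(z_1,\ldots,z_r)$: $|\boldsymbol{k}|=k_1+\cdots+k_r$; $\overrightarrow{\boldsymbol{k}}_j=(k_1,\ldots,k_j)$; $\overleftarrow{\boldsymbol{k}}_j=(k_r,k_{r-1},\ldots,k_{r+1-j})$;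 $|\overleftarrow{\boldsymbol{k}}_j|=k_r+\cdots+k_{r+1-j}$; $\overrightarrow{\boldsymbol{z}}_j=(z_1,\ldots,z_j)$; $\overleftarrow{\boldsymbol{z}}_j=(z_r,\ldots,z_{r+1-j})$; for $j=0$ these are empty and have weight $0$. Empty sums are $0$. *)

theory Defs
  imports "HOL-Complex_Analysis.Complex_Analysis"
begin

text \<open>The restriction to poles matters: \<open>zorder\<close> has no specified value for functions
  vanishing near the point. Values of \<open>f\<close> at the poles themselves are arbitrary.\<close>
definition meromorphic_log_sing :: "(complex \<Rightarrow> complex) \<Rightarrow> bool" where
  "meromorphic_log_sing f \<longleftrightarrow>
     f meromorphic_on UNIV \<and> (\<forall>a. is_pole f a \<longrightarrow> zorder f a = -1)"

text \<open>The variables \<open>t\<^sub>1 < \<dots> < t\<^sub>n\<close> are the values \<open>t 0, \<dots>, t (n - 1)\<close>.\<close>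
definition open_simplex :: "nat \<Rightarrow> real \<Rightarrow> (nat \<Rightarrow> real) set" where
  "open_simplex n x =
     {t. (\<forall>i<n. 0 < t i \<and> t i < x) \<and> (\<forall>i j. i < j \<and> j < n \<longrightarrow> t i < t j)}"

text \<open>The head of the list belongs to the innermost variable \<open>t\<^sub>1\<close>.
  For the empty list the integral is \<open>1\<close> (one-point product space).\<close>
definition iter_int :: "(complex \<Rightarrow> complex) list \<Rightarrow> real \<Rightarrow> complex" where
  "iter_int fs x =
     (LINT t:open_simplex (length fs) x | (\<Pi>\<^sub>M i\<in>{..<length fs}. (lborel :: real measure)).
        (\<Prod>i<length fs. (fs ! i) (of_real (t i))))"

definition iter_int_abs_conv :: "(complex \<Rightarrow> complex) list \<Rightarrow> real \<Rightarrow> bool" where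
  "iter_int_abs_conv fs x \<longleftrightarrow>
     set_integrable (\<Pi>\<^sub>M i\<in>{..<length fs}. (lborel :: real measure))
       (open_simplex (length fs) x) (\<lambda>t. \<Prod>i<length fs. (fs ! i) (of_real (t i)))"

text \<open>In all of the following, the two lists are the upper and lower row; they are meant
  to have equal length, with positive entries in the lower row.\<close>
definition L_word ::
  "(complex \<Rightarrow> complex) \<Rightarrow> (complex \<Rightarrow> complex) list \<Rightarrow> nat list \<Rightarrow> (complex \<Rightarrow> complex) list" where
  "L_word z0 ws ms = concat (map2 (\<lambda>w m. w # replicate (m - 1) z0) ws ms)"

definition L ::
  "(complex \<Rightarrow> complex) \<Rightarrow> (complex \<Rightarrow> complex) list \<Rightarrow> nat list \<Rightarrow> real \<Rightarrow> complex" where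
  "L z0 ws ms x = iter_int (L_word z0 ws ms) x"

definition L_abs_conv ::
  "(complex \<Rightarrow> complex) \<Rightarrow> (complex \<Rightarrow> complex) list \<Rightarrow> nat list \<Rightarrow> real \<Rightarrow> bool" where
  "L_abs_conv z0 ws ms x \<longleftrightarrow> iter_int_abs_conv (L_word z0 ws ms) x"

definition xi ::
  "(complex \<Rightarrow> complex) \<Rightarrow> real \<Rightarrow> (complex \<Rightarrow> complex) list \<Rightarrow> nat list \<Rightarrow>
   (complex \<Rightarrow> complex) \<Rightarrow> nat \<Rightarrow> complex" where
  "xi z0 x ws ms w p =
     (LINT t:{0<..<x} | lborel.
        L z0 (replicate p w) (replicate p 1) t * z0 (of_real t) * L z0 ws ms t)"

text \<open>Absolute convergence of the outer integral and of the two inner ones at every point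
  of the range of integration.\<close>
definition xi_abs_conv ::
  "(complex \<Rightarrow> complex) \<Rightarrow> real \<Rightarrow> (complex \<Rightarrow> complex) list \<Rightarrow> nat list \<Rightarrow>
   (complex \<Rightarrow> complex) \<Rightarrow> nat \<Rightarrow> bool" where
  "xi_abs_conv z0 x ws ms w p \<longleftrightarrow>
     (\<forall>t\<in>{0<..<x}. L_abs_conv z0 (replicate p w) (replicate p 1) t \<and> L_abs_conv z0 ws ms t) \<and>
     set_integrable lborel {0<..<x}
       (\<lambda>t. L z0 (replicate p w) (replicate p 1) t * z0 (of_real t) * L z0 ws ms t)"

text \<open>A tuple \<open>(a\<^sub>1, \<dots>, a\<^sub>r)\<close> is given by a function \<open>a\<close> indexed from \<open>1\<close>:
  \<open>fwd a j = [a 1, \<dots>, a j]\<close> and \<open>bwd r a j = [a r, a (r - 1), \<dots>, a (r + 1 - j)]\<close>.\<close>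
definition fwd :: "(nat \<Rightarrow> 'a) \<Rightarrow> nat \<Rightarrow> 'a list" where
  "fwd a j = map a [1..<j + 1]"

definition bwd :: "nat \<Rightarrow> (nat \<Rightarrow> 'a) \<Rightarrow> nat \<Rightarrow> 'a list" where
  "bwd r a j = map (\<lambda>i. a (r - i)) [0..<j]"

end

(* Concatenate all letters into one word, z_1^q z_0^(k_1-1) z_2 ... z_r z_0^(k_r-1) z_(r+1)^p.
   Cut it before or after a letter u, and let J(u) be the integral over 0 < t < x of u(t) times the
   iterated integral of the part left of u and that of the reversed part right of u.
   Integration by parts (Fubini, splitting a product of two absolutely convergent one-dimensional
   integrals along the diagonal) shows that the product of the two iterated integrals at a cut
   between neighbours u, v is J(u) + J(v). The products on the right-hand side are exactly those
   of the cuts between the first and the last letter z_0, with alternating signs, so the sum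
   telescopes to J of the last z_0 minus (up to sign) J of the first z_0, and these are
   the two values of xi. *)
theory Submission
  imports Defs
begin

section \<open>Finite product measures and measurability of the simplex\<close>

text \<open>Tonelli for the norm carries integrability over to the pair measure, where Fubini can be
  applied.\<close>

lemma (in product_sigma_finite) integrable_PiM_insert:
  fixes f :: "_ \<Rightarrow> _::{banach, second_countable_topology}"
  assumes I: "finite I" "i \<notin> I" and f: "integrable (Pi\<^sub>M (insert i I) M) f"
  shows "integrable (Pi\<^sub>M I M \<Otimes>\<^sub>M M i) (\<lambda>(X, y). f (X(i := y)))"
proof -
  interpret I: finite_product_sigma_finite M I by standard (rule I)
  interpret P: pair_sigma_finite "Pi\<^sub>M I M" "M i" ..
  have [measurable]: "f \<in> borel_measurable (Pi\<^sub>M (insert i I) M)"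
    using f by auto
  have "(\<integral>\<^sup>+z. norm (case z of (X, y) \<Rightarrow> f (X(i := y))) \<partial>(Pi\<^sub>M I M \<Otimes>\<^sub>M M i))
      = (\<integral>\<^sup>+X. \<integral>\<^sup>+y. norm (f (X(i := y))) \<partial>M i \<partial>Pi\<^sub>M I M)"
    by (subst sigma_finite_measure.nn_integral_fst[OF sigma_finite_measures, symmetric]) simp_all
  also have "\<dots> = (\<integral>\<^sup>+t. norm (f t) \<partial>Pi\<^sub>M (insert i I) M)"
    using I by (subst product_nn_integral_insert) auto
  also have "\<dots> < \<infinity>"
    using f by (simp add: integrable_iff_bounded)
  finally show ?thesis
    unfolding integrable_iff_bounded by auto
qed

text \<open>\<open>product_integral_insert\<close> has the new coordinate innermost; Fubini moves it
  outermost, as suits the largest variable of a simplex, which bounds all others.\<close>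

lemma (in product_sigma_finite) integral_PiM_insert_rev:
  fixes f :: "_ \<Rightarrow> _::{banach, second_countable_topology}"
  assumes I: "finite I" "i \<notin> I" and f: "integrable (Pi\<^sub>M (insert i I) M) f"
  shows "integrable (M i) (\<lambda>y. \<integral>X. f (X(i := y)) \<partial>Pi\<^sub>M I M)"
    and "integral\<^sup>L (Pi\<^sub>M (insert i I) M) f = (\<integral>y. (\<integral>X. f (X(i := y)) \<partial>Pi\<^sub>M I M) \<partial>M i)"
proof -
  interpret I: finite_product_sigma_finite M I by standard (rule I)
  interpret P: pair_sigma_finite "Pi\<^sub>M I M" "M i" ..
  note int = integrable_PiM_insert[OF assms]
  show "integrable (M i) (\<lambda>y. \<integral>X. f (X(i := y)) \<partial>Pi\<^sub>M I M)"
    using P.integrable_snd[OF int] .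
  show "integral\<^sup>L (Pi\<^sub>M (insert i I) M) f = (\<integral>y. (\<integral>X. f (X(i := y)) \<partial>Pi\<^sub>M I M) \<partial>M i)"
    unfolding product_integral_insert[OF assms] P.Fubini_integral[OF int] ..
qed

text \<open>The intersection is needed because \<open>open_simplex\<close> also contains functions that are not
  \<open>undefined\<close> outside the index set.\<close>
lemma open_simplex_measurable:
  "open_simplex n x \<inter> space (\<Pi>\<^sub>M i\<in>{..<n}. (lborel :: real measure))
     \<in> sets (\<Pi>\<^sub>M i\<in>{..<n}. (lborel :: real measure))"
proof -
  let ?M = "\<Pi>\<^sub>M i\<in>{..<n}. (lborel :: real measure)"
  have c [measurable]: "(\<lambda>t. t i) \<in> borel_measurable ?M" if "i < n" for i
    using that by (simp add: measurable_component_singleton[where M = "\<lambda>_. lborel", simplified])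
  have "Measurable.pred ?M (\<lambda>t. i < n \<longrightarrow> 0 < t i \<and> t i < x)" for i
    by (cases "i < n") simp_all
  moreover have "Measurable.pred ?M (\<lambda>t. i < j \<and> j < n \<longrightarrow> t i < t j)" for i j
    by (cases "i < j \<and> j < n") simp_all
  ultimately have "Measurable.pred ?M
     (\<lambda>t. (\<forall>i. i < n \<longrightarrow> 0 < t i \<and> t i < x) \<and> (\<forall>i j. i < j \<and> j < n \<longrightarrow> t i < t j))"
    by simp
  then have "{t \<in> space ?M. (\<forall>i. i < n \<longrightarrow> 0 < t i \<and> t i < x) \<and>
      (\<forall>i j. i < j \<and> j < n \<longrightarrow> t i < t j)} \<in> sets ?M"
    by (simp only: pred_def)
  also have "{t \<in> space ?M. (\<forall>i. i < n \<longrightarrow> 0 < t i \<and> t i < x) \<and>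
      (\<forall>i j. i < j \<and> j < n \<longrightarrow> t i < t j)} = open_simplex n x \<inter> space ?M"
    by (auto simp: open_simplex_def)
  finally show ?thesis .
qed

section \<open>Absolutely convergent iterated integrals\<close>

text \<open>Convergence at \<open>x\<close> thus suffices to peel off a letter at every upper limit
  \<open>t \<le> x\<close>.\<close>

lemma iter_int_abs_conv_mono:
  assumes "iter_int_abs_conv fs x" "y \<le> x"
  shows "iter_int_abs_conv fs y"
proof -
  let ?M = "\<Pi>\<^sub>M i\<in>{..<length fs}. (lborel :: real measure)"
  let ?f = "\<lambda>t::nat \<Rightarrow> real. \<Prod>i<length fs. (fs ! i) (of_real (t i))"
  have "open_simplex (length fs) y \<subseteq> open_simplex (length fs) x"
    using assms(2) by (force simp: open_simplex_def)
  \<comment> \<open>Intersecting with the space changes nothing on it and makes the simplex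
    measurable.\<close>
  moreover have "set_integrable ?M (open_simplex (length fs) x \<inter> space ?M) ?f"
    using assms(1) unfolding iter_int_abs_conv_def set_integrable_def
    by (rule Bochner_Integration.integrable_cong[THEN iffD1, rotated 2]) (auto simp: indicator_def)
  ultimately have "set_integrable ?M (open_simplex (length fs) y \<inter> space ?M) ?f"
    by (intro set_integrable_subset[OF _ open_simplex_measurable]) auto
  then show ?thesis
    unfolding iter_int_abs_conv_def set_integrable_def
    by (rule Bochner_Integration.integrable_cong[THEN iffD1, rotated 2]) (auto simp: indicator_def)
qed

lemma fun_upd_in_open_simplex_Suc:
  "t(n := y) \<in> open_simplex (Suc n) x \<longleftrightarrow> 0 < y \<and> y < x \<and> t \<in> open_simplex n y"
  unfolding open_simplex_def by (fastforce simp: less_Suc_eq)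

text \<open>The last letter belongs to the largest variable; integrating over that one last leaves a
  simplex whose upper limit it is.\<close>

lemma
  assumes "iter_int_abs_conv (fs @ [f]) x"
  shows set_integrable_iter_int_snoc:
      "set_integrable lborel {0<..<x} (\<lambda>t. iter_int fs t * f (of_real t))" (is ?int)
    and iter_int_snoc:
      "iter_int (fs @ [f]) x = (LINT t:{0<..<x}|lborel. iter_int fs t * f (of_real t))" (is ?eq)
proof -
  interpret product_sigma_finite "\<lambda>_::nat. lborel :: real measure" ..
  let ?n = "length fs"
  let ?F = "\<lambda>t::nat \<Rightarrow> real. indicat_real (open_simplex (Suc ?n) x) t *\<^sub>R
      (\<Prod>i<Suc ?n. ((fs @ [f]) ! i) (of_real (t i)))"
  have int: "integrable (Pi\<^sub>M (insert ?n {..<?n}) (\<lambda>_. lborel)) ?F"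
    using assms by (simp add: iter_int_abs_conv_def set_integrable_def lessThan_Suc)
  have upd: "?F (X(?n := y)) = indicat_real {0<..<x} y *\<^sub>R (f (of_real y) *
      (indicat_real (open_simplex ?n y) X *\<^sub>R (\<Prod>i<?n. (fs ! i) (of_real (X i)))))" for X y
    by (auto simp: indicator_def fun_upd_in_open_simplex_Suc nth_append)
  \<comment> \<open>The inner integral may diverge for some \<open>y\<close>; the rules for constant
    factors also hold with the default value 0.\<close>
  have inner: "(\<integral>X. ?F (X(?n := y)) \<partial>Pi\<^sub>M {..<?n} (\<lambda>_. lborel))
      = indicat_real {0<..<x} y *\<^sub>R (iter_int fs y * f (of_real y))" for y
    unfolding upd integral_scaleR_right integral_mult_right_zero
    by (simp add: iter_int_def set_lebesgue_integral_def mult.commute)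
  have fin: "finite {..<?n}" "?n \<notin> {..<?n}"
    by simp_all
  show ?int
    using integral_PiM_insert_rev(1)[OF fin int] unfolding inner set_integrable_def .
  show ?eq
    using integral_PiM_insert_rev(2)[OF fin int] unfolding inner
    by (simp add: iter_int_def set_lebesgue_integral_def lessThan_Suc)
qed

section \<open>Integration by parts\<close>

text \<open>The double integral over the square is cut along the diagonal, and in each half the
  larger variable is made the outer one.\<close>

lemma set_integral_mult_split:
  fixes a b :: "real \<Rightarrow> complex"
  assumes a: "set_integrable lborel {0<..<x} a" and b: "set_integrable lborel {0<..<x} b"
  shows "(LINT t:{0<..<x}|lborel. a t) * (LINT t:{0<..<x}|lborel. b t)
    = (LINT t:{0<..<x}|lborel. a t * (LINT s:{0<..<t}|lborel. b s))
      + (LINT t:{0<..<x}|lborel. (LINT s:{0<..<t}|lborel. a s) * b t)"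
proof -
  define a' where "a' t = indicat_real {0<..<x} t *\<^sub>R a t" for t
  define b' where "b' t = indicat_real {0<..<x} t *\<^sub>R b t" for t
  have ia [measurable]: "integrable lborel a'" and ib [measurable]: "integrable lborel b'"
    using a b by (simp_all add: a'_def[abs_def] b'_def[abs_def] set_integrable_def)
  have [measurable]: "a' \<in> borel_measurable borel" "b' \<in> borel_measurable borel"
    using ia ib by auto
  have iab: "integrable (lborel \<Otimes>\<^sub>M lborel) (\<lambda>(s, t). a' s * b' t)"
    using ia ib by (intro lborel_pair.Fubini_integrable)
      (auto simp: norm_mult intro!: integrable_mult_left integrable_mult_right)
  have i1: "integrable (lborel \<Otimes>\<^sub>M lborel) (\<lambda>(s, t). indicat_real {..<s} t *\<^sub>R (a' s * b' t))"
    by (rule Bochner_Integration.integrable_bound[OF iab])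
      (auto simp: indicator_def split_beta')
  have i2: "integrable (lborel \<Otimes>\<^sub>M lborel) (\<lambda>(s, t). indicat_real {..<t} s *\<^sub>R (a' s * b' t))"
    by (rule Bochner_Integration.integrable_bound[OF iab])
      (auto simp: indicator_def split_beta')
  \<comment> \<open>Below \<open>s < x\<close> the zero extension is supported in
    \<open>{0<..<s}\<close>; outer variables outside \<open>{0<..<x}\<close> contribute 0 through
    the other factor.\<close>
  have cut: "(\<integral>t. indicat_real {..<s} t *\<^sub>R g' t \<partial>lborel) = (LINT t:{0<..<s}|lborel. g t)"
    if "s < x" "\<And>t. g' t = indicat_real {0<..<x} t *\<^sub>R g t" for s and g g' :: "real \<Rightarrow> complex"
    unfolding set_lebesgue_integral_def that(2) using that(1)
    by (intro Bochner_Integration.integral_cong) (auto simp: indicator_def)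
  have "(\<integral>s. a' s \<partial>lborel) * (\<integral>t. b' t \<partial>lborel) = (\<integral>s. (\<integral>t. a' s * b' t \<partial>lborel) \<partial>lborel)"
    by simp
  also have "\<dots> = (\<integral>s. (\<integral>t. indicat_real {..<s} t *\<^sub>R (a' s * b' t) \<partial>lborel)
      + (\<integral>t. indicat_real {..<t} s *\<^sub>R (a' s * b' t) \<partial>lborel) \<partial>lborel)"
  proof (intro Bochner_Integration.integral_cong refl)
    fix s :: real
    have i: "integrable lborel (\<lambda>t. a' s * b' t)"
      using ib by simp
    have "(\<integral>t. a' s * b' t \<partial>lborel) = (\<integral>t. indicat_real {..<s} t *\<^sub>R (a' s * b' t)
       + indicat_real {..<t} s *\<^sub>R (a' s * b' t) \<partial>lborel)"
      \<comment> \<open>Both indicators vanish only at \<open>t = s\<close>, a null set.\<close>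
      by (intro integral_cong_AE) (use AE_lborel_singleton[of s] in \<open>auto simp: indicator_def\<close>)
    also have "\<dots> = (\<integral>t. indicat_real {..<s} t *\<^sub>R (a' s * b' t) \<partial>lborel)
      + (\<integral>t. indicat_real {..<t} s *\<^sub>R (a' s * b' t) \<partial>lborel)"
      by (intro Bochner_Integration.integral_add; rule Bochner_Integration.integrable_bound[OF i])
        (auto simp: indicator_def)
    finally show "(\<integral>t. a' s * b' t \<partial>lborel) = \<dots>" .
  qed
  also have "\<dots> = (\<integral>s. (\<integral>t. indicat_real {..<s} t *\<^sub>R (a' s * b' t) \<partial>lborel) \<partial>lborel)
      + (\<integral>s. (\<integral>t. indicat_real {..<t} s *\<^sub>R (a' s * b' t) \<partial>lborel) \<partial>lborel)"
    by (intro Bochner_Integration.integral_add lborel_pair.integrable_fst i1 i2)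
  also have "(\<integral>s. (\<integral>t. indicat_real {..<t} s *\<^sub>R (a' s * b' t) \<partial>lborel) \<partial>lborel)
      = (\<integral>t. (\<integral>s. indicat_real {..<t} s *\<^sub>R (a' s * b' t) \<partial>lborel) \<partial>lborel)"
    by (rule lborel_pair.Fubini_integral[OF i2, symmetric])
  also have "\<dots> = (LINT t:{0<..<x}|lborel. (LINT s:{0<..<t}|lborel. a s) * b t)"
    unfolding set_lebesgue_integral_def[of _ "{0<..<x}"]
  proof (intro Bochner_Integration.integral_cong refl)
    fix t :: real
    have "(\<integral>s. indicat_real {..<t} s *\<^sub>R (a' s * b' t) \<partial>lborel)
        = (\<integral>s. indicat_real {..<t} s *\<^sub>R a' s \<partial>lborel) * b' t"
      by (subst integral_mult_left_zero[symmetric]) simp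
    then show "(\<integral>s. indicat_real {..<t} s *\<^sub>R (a' s * b' t) \<partial>lborel)
        = indicat_real {0<..<x} t *\<^sub>R ((LINT s:{0<..<t}|lborel. a s) * b t)"
      using cut[OF _ a'_def, of t] by (cases "t \<in> {0<..<x}") (simp_all add: b'_def)
  qed
  also have "(\<integral>s. (\<integral>t. indicat_real {..<s} t *\<^sub>R (a' s * b' t) \<partial>lborel) \<partial>lborel)
      = (LINT t:{0<..<x}|lborel. a t * (LINT s:{0<..<t}|lborel. b s))"
    unfolding set_lebesgue_integral_def[of _ "{0<..<x}"]
  proof (intro Bochner_Integration.integral_cong refl)
    fix s :: real
    have "(\<integral>t. indicat_real {..<s} t *\<^sub>R (a' s * b' t) \<partial>lborel)
        = a' s * (\<integral>t. indicat_real {..<s} t *\<^sub>R b' t \<partial>lborel)"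
      by (subst integral_mult_right_zero[symmetric]) simp
    then show "(\<integral>t. indicat_real {..<s} t *\<^sub>R (a' s * b' t) \<partial>lborel)
        = indicat_real {0<..<x} s *\<^sub>R (a s * (LINT t:{0<..<s}|lborel. b t))"
      using cut[OF _ b'_def, of s] by (cases "s \<in> {0<..<x}") (simp_all add: a'_def)
  qed
  finally show ?thesis
    by (simp add: a'_def b'_def set_lebesgue_integral_def)
qed

text \<open>This is the quantity \<open>J(f)\<close> of the overview, with \<open>gs\<close> the
  reversed part right of \<open>f\<close>. Both values of \<open>xi\<close> have this shape.\<close>

definition glued_int ::
  "(complex \<Rightarrow> complex) list \<Rightarrow> (complex \<Rightarrow> complex) \<Rightarrow> (complex \<Rightarrow> complex) list \<Rightarrow> real \<Rightarrow> complex" where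
  "glued_int fs f gs x = (LINT t:{0<..<x}|lborel. iter_int fs t * f (of_real t) * iter_int gs t)"

text \<open>The cut lies between the neighbours \<open>f\<close> and \<open>g\<close> of the word
  \<open>fs @ [f, g] @ rev gs\<close>.\<close>

lemma iter_int_mult:
  assumes f: "iter_int_abs_conv (fs @ [f]) x" and g: "iter_int_abs_conv (gs @ [g]) x"
  shows "iter_int (fs @ [f]) x * iter_int (gs @ [g]) x
    = glued_int fs f (gs @ [g]) x + glued_int (fs @ [f]) g gs x"
proof -
  have f': "iter_int (fs @ [f]) t = (LINT s:{0<..<t}|lborel. iter_int fs s * f (of_real s))"
    and g': "iter_int (gs @ [g]) t = (LINT s:{0<..<t}|lborel. iter_int gs s * g (of_real s))"
    if "t \<le> x" for t
    using that f g by (blast intro: iter_int_snoc iter_int_abs_conv_mono)+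
  have "glued_int fs f (gs @ [g]) x = (LINT t:{0<..<x}|lborel. iter_int fs t * f (of_real t) *
      (LINT s:{0<..<t}|lborel. iter_int gs s * g (of_real s)))"
    unfolding glued_int_def by (intro set_lebesgue_integral_cong) (auto simp: g')
  moreover have "glued_int (fs @ [f]) g gs x = (LINT t:{0<..<x}|lborel.
      (LINT s:{0<..<t}|lborel. iter_int fs s * f (of_real s)) * (iter_int gs t * g (of_real t)))"
    unfolding glued_int_def by (intro set_lebesgue_integral_cong) (auto simp: f')
  ultimately show ?thesis
    using set_integral_mult_split[OF set_integrable_iter_int_snoc[OF f]
      set_integrable_iter_int_snoc[OF g]]
    by (simp add: f' g')
qed

section \<open>Words of index rows and telescoping sums\<close>

lemma fwd_Suc: "fwd a (Suc j) = fwd a j @ [a (Suc j)]"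
  by (simp add: fwd_def)

lemma bwd_Suc: "bwd r a (Suc j) = bwd r a j @ [a (r - j)]"
  by (simp add: bwd_def)

lemma length_fwd [simp]: "length (fwd a j) = j"
  by (simp add: fwd_def)

lemma length_bwd [simp]: "length (bwd r a j) = j"
  by (simp add: bwd_def)

lemma bwd_full: "bwd r a r = rev (fwd a r)"
  by (rule nth_equalityI) (simp_all add: bwd_def fwd_def rev_nth Suc_diff_Suc del: upt_Suc)

lemma L_word_snoc:
  "length ws = length ms \<Longrightarrow>
     L_word z0 (ws @ [w]) (ms @ [m]) = L_word z0 ws ms @ w # replicate (m - 1) z0"
  by (simp add: L_word_def)

lemma L_word_replicate_one: "L_word z0 (replicate n w) (replicate n 1) = replicate n w"
  by (induction n) (simp_all add: L_word_def)

text \<open>In rows starting with \<open>z (r + 1)\<close> the last letter is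
  \<open>z (r + 1)\<close> or some \<open>z (r + 1 - j)\<close>; here it need not be named.\<close>

lemma L_word_last:
  assumes "length ws = Suc (length ms)"
  shows "L_word z0 ws (ms @ [m]) = L_word z0 ws (ms @ [1]) @ replicate (m - 1) z0"
  using assms by (cases ws rule: rev_cases) (simp_all add: L_word_snoc)

lemma alternating_sum_telescope:
  fixes a :: "nat \<Rightarrow> 'a::comm_ring_1"
  shows "(\<Sum>i = 1..n. (- 1) ^ (i - 1) * (a i + a (Suc i))) = a 1 - (- 1) ^ n * a (Suc n)"
  by (induction n) (simp_all add: algebra_simps)

text \<open>\<open>t j\<close> and \<open>l j\<close> stand for the values at the two ends of block
  \<open>j\<close>; the second sum links the end of a block to the start of the next.\<close>

lemma block_sum_telescope:
  fixes s t l :: "nat \<Rightarrow> 'a::comm_ring_1"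
  shows "(\<Sum>j<Suc n. s j * t j - s (Suc j) * l j) + (\<Sum>j<n. s (Suc j) * (l j - t (Suc j)))
    = s 0 * t 0 - s (Suc n) * l n"
  by (induction n) (simp_all add: algebra_simps)

section \<open>Summation over the cuts of the word\<close>

theorem theorem2p1:
  fixes p q r :: nat and k :: "nat \<Rightarrow> nat"
    and z :: "nat \<Rightarrow> complex \<Rightarrow> complex" and x :: real
  assumes "p \<ge> 1" and "q \<ge> 1" and "r \<ge> 1"
    and "\<And>j. 1 \<le> j \<Longrightarrow> j \<le> r \<Longrightarrow> k j \<ge> 2"
    and "\<And>i. i \<le> r + 1 \<Longrightarrow> meromorphic_log_sing (z i)"
    and "x > 0"
    and "xi_abs_conv (z 0) x
           (replicate (q - 1) (z 1) @ fwd z r)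
           (replicate (q - 1) 1 @ fwd k (r - 1) @ [k r - 1]) (z (r + 1)) p"
    and "xi_abs_conv (z 0) x
           (replicate p (z (r + 1)) @ bwd r z (r - 1))
           (replicate (p - 1) 1 @ bwd r k (r - 1) @ [k 1 - 1]) (z 1) q"
    and "\<And>j i. j < r \<Longrightarrow> 1 \<le> i \<Longrightarrow> i \<le> k (r - j) - 2 \<Longrightarrow>
           L_abs_conv (z 0) (replicate p (z (r + 1)) @ bwd r z j)
             (replicate (p - 1) 1 @ bwd r k j @ [i + 1]) x"
    and "\<And>j i. j < r \<Longrightarrow> 1 \<le> i \<Longrightarrow> i \<le> k (r - j) - 2 \<Longrightarrow>
           L_abs_conv (z 0) (replicate (q - 1) (z 1) @ fwd z (r - j))
             (replicate (q - 1) 1 @ fwd k (r - j - 1) @ [k (r - j) - i]) x"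
    and "\<And>j. j < r - 1 \<Longrightarrow>
           L_abs_conv (z 0) (replicate p (z (r + 1)) @ bwd r z j)
             (replicate (p - 1) 1 @ bwd r k (j + 1)) x"
    and "\<And>j. j < r - 1 \<Longrightarrow>
           L_abs_conv (z 0) (replicate (q - 1) (z 1) @ fwd z (r - j))
             (replicate (q - 1) 1 @ fwd k (r - j - 1) @ [1]) x"
    and "\<And>j. j < r - 1 \<Longrightarrow>
           L_abs_conv (z 0) (replicate p (z (r + 1)) @ bwd r z (j + 1))
             (replicate (p - 1) 1 @ bwd r k (j + 1) @ [1]) x"
    and "\<And>j. j < r - 1 \<Longrightarrow>
           L_abs_conv (z 0) (replicate (q - 1) (z 1) @ fwd z (r - j - 1))
             (replicate (q - 1) 1 @ fwd k (r - j - 1)) x"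
  shows
    "xi (z 0) x
       (replicate (q - 1) (z 1) @ fwd z r)
       (replicate (q - 1) 1 @ fwd k (r - 1) @ [k r - 1]) (z (r + 1)) p
     - (-1) ^ sum_list (fwd k r) *
       xi (z 0) x
         (replicate p (z (r + 1)) @ bwd r z (r - 1))
         (replicate (p - 1) 1 @ bwd r k (r - 1) @ [k 1 - 1]) (z 1) q
     = (\<Sum>j<r. (-1) ^ sum_list (bwd r k j) *
         (\<Sum>i = 1..k (r - j) - 2. (-1) ^ (i - 1) *
           L (z 0) (replicate p (z (r + 1)) @ bwd r z j)
             (replicate (p - 1) 1 @ bwd r k j @ [i + 1]) x *
           L (z 0) (replicate (q - 1) (z 1) @ fwd z (r - j))
             (replicate (q - 1) 1 @ fwd k (r - j - 1) @ [k (r - j) - i]) x))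
     + (\<Sum>j<r - 1. (-1) ^ sum_list (bwd r k (j + 1)) *
         (L (z 0) (replicate p (z (r + 1)) @ bwd r z j)
            (replicate (p - 1) 1 @ bwd r k (j + 1)) x *
          L (z 0) (replicate (q - 1) (z 1) @ fwd z (r - j))
            (replicate (q - 1) 1 @ fwd k (r - j - 1) @ [1]) x
          - L (z 0) (replicate p (z (r + 1)) @ bwd r z (j + 1))
              (replicate (p - 1) 1 @ bwd r k (j + 1) @ [1]) x *
            L (z 0) (replicate (q - 1) (z 1) @ fwd z (r - j - 1))
              (replicate (q - 1) 1 @ fwd k (r - j - 1)) x))"
proof -
  let ?w = "z (r + 1)"
  let ?R = "\<lambda>n. replicate n (z 0)"
  \<comment> \<open>Block \<open>j\<close> is that of the letter \<open>z (r - j)\<close>: \<open>P j\<close> is the part of the word before this letter,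
    \<open>A j\<close> includes it, and \<open>S j\<close> is the reversed part after the block. \<open>T j i\<close> is the integral
    attached to the \<open>i\<close>-th letter \<open>z 0\<close> from the right in this block.\<close>
  define P where "P j = L_word (z 0) (replicate (q - 1) (z 1) @ fwd z (r - j - 1))
    (replicate (q - 1) 1 @ fwd k (r - j - 1))" for j
  define A where "A j = P j @ [z (r - j)]" for j
  define S where "S j = L_word (z 0) (replicate p ?w @ bwd r z j)
    (replicate (p - 1) 1 @ bwd r k j @ [1])" for j
  define T where
    "T j i = glued_int (A j @ ?R (k (r - j) - 1 - i)) (z 0) (S j @ ?R (i - 1)) x" for j i
  define s where "s j = (- 1 :: complex) ^ sum_list (bwd r k j)" for j

  have k2: "k (r - j) \<ge> 2" if "j < r" for j
    using that assms(4) by simp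
  have pre: "L_word (z 0) (replicate (q - 1) (z 1) @ fwd z (r - j))
      (replicate (q - 1) 1 @ fwd k (r - j - 1) @ [c]) = A j @ ?R (c - 1)" if "j < r" for j c
  proof -
    have "Suc (r - j - 1) = r - j"
      using that by simp
    then have "fwd z (r - j) = fwd z (r - j - 1) @ [z (r - j)]"
      using fwd_Suc[of z "r - j - 1"] by simp
    then show ?thesis
      using L_word_snoc[of "replicate (q - 1) (z 1) @ fwd z (r - j - 1)"
          "replicate (q - 1) 1 @ fwd k (r - j - 1)" "z 0" "z (r - j)" c]
      by (simp add: A_def P_def)
  qed
  \<comment> \<open>Read backwards, block \<open>j\<close> begins with its letters
    \<open>z 0\<close>, which lengthen the run after the last letter of \<open>S j\<close>;
    \<open>z (r - j)\<close> itself only enters \<open>S (Suc j)\<close>. Hence the shift to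
    \<open>p - 1\<close> ones.\<close>
  have suf: "L_word (z 0) (replicate p ?w @ bwd r z j)
      (replicate (p - 1) 1 @ bwd r k j @ [c]) = S j @ ?R (c - 1)" for j c
    using L_word_last[of "replicate p ?w @ bwd r z j" "replicate (p - 1) 1 @ bwd r k j" "z 0" c]
      assms(1) by (simp add: S_def)
  have suf': "L_word (z 0) (replicate p ?w @ bwd r z j) (replicate (p - 1) 1 @ bwd r k (j + 1))
      = S j @ ?R (k (r - j) - 1)" for j
    using suf[of j "k (r - j)"] by (simp add: bwd_Suc)
  have P_Suc: "P j = A (Suc j) @ ?R (k (r - Suc j) - 1)" if "j < r - 1" for j
  proof -
    have j: "Suc j < r" "Suc (r - Suc j - 1) = r - Suc j"
      using that by simp_all
    have "P j = L_word (z 0) (replicate (q - 1) (z 1) @ fwd z (r - Suc j))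
        (replicate (q - 1) 1 @ fwd k (r - Suc j))"
      by (simp add: P_def)
    also have "fwd k (r - Suc j) = fwd k (r - Suc j - 1) @ [k (r - Suc j)]"
      using fwd_Suc[of k "r - Suc j - 1"] unfolding j(2) .
    finally show ?thesis
      unfolding pre[OF j(1)] .
  qed
  have S_Suc: "S (Suc j) = (S j @ ?R (k (r - j) - 1)) @ [z (r - j)]" for j
    using L_word_snoc[of "replicate p ?w @ bwd r z j" "replicate (p - 1) 1 @ bwd r k (j + 1)"
        "z 0" "z (r - j)" 1] suf'[of j] assms(1) by (simp add: S_def bwd_Suc)
  have S_0: "S 0 = replicate p ?w"
    using L_word_replicate_one[of "z 0" p ?w] assms(1)
    by (cases p) (simp_all add: S_def bwd_def replicate_append_same)
  have s_Suc: "s (Suc j) = s j * (- 1) ^ k (r - j)" for j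
    by (simp add: s_def bwd_Suc power_add)
  have R_snoc: "?R n = ?R (n - 1) @ [z 0]" if "n \<ge> 1" for n
    using that by (cases n) (simp_all add: replicate_append_same)

  \<comment> \<open>These are the cuts between two letters \<open>z 0\<close> of block
    \<open>j\<close>, with \<open>i\<close> of them on the right. For \<open>k (r - j) = 2\<close>
    both sides are 0.\<close>
  have inner: "(\<Sum>i = 1..k (r - j) - 2. (- 1) ^ (i - 1) *
      L (z 0) (replicate p ?w @ bwd r z j) (replicate (p - 1) 1 @ bwd r k j @ [i + 1]) x *
      L (z 0) (replicate (q - 1) (z 1) @ fwd z (r - j))
        (replicate (q - 1) 1 @ fwd k (r - j - 1) @ [k (r - j) - i]) x)
    = T j 1 - (- 1) ^ k (r - j) * T j (k (r - j) - 1)" if j: "j < r" for j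
  proof -
    have "(\<Sum>i = 1..k (r - j) - 2. (- 1) ^ (i - 1) *
        L (z 0) (replicate p ?w @ bwd r z j) (replicate (p - 1) 1 @ bwd r k j @ [i + 1]) x *
        L (z 0) (replicate (q - 1) (z 1) @ fwd z (r - j))
          (replicate (q - 1) 1 @ fwd k (r - j - 1) @ [k (r - j) - i]) x)
      = (\<Sum>i = 1..k (r - j) - 2. (- 1) ^ (i - 1) * (T j i + T j (Suc i)))"
    proof (rule sum.cong[OF refl])
      fix i assume "i \<in> {1..k (r - j) - 2}"
      then have i: "1 \<le> i" "i \<le> k (r - j) - 2" "k (r - j) - i - 1 \<ge> 1"
        by auto
      have "A j @ ?R (k (r - j) - i - 1) = (A j @ ?R (k (r - j) - 1 - Suc i)) @ [z 0]"
        using R_snoc[OF i(3)] by (simp add: diff_diff_add)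
      moreover have "S j @ ?R i = (S j @ ?R (i - 1)) @ [z 0]"
        using R_snoc[OF i(1)] by simp
      moreover have "iter_int_abs_conv (A j @ ?R (k (r - j) - i - 1)) x"
        using assms(10)[OF j i(1,2)] unfolding L_abs_conv_def pre[OF j] .
      moreover have "iter_int_abs_conv (S j @ ?R i) x"
        using assms(9)[OF j i(1,2)] unfolding L_abs_conv_def suf by simp
      ultimately have "iter_int (S j @ ?R i) x * iter_int (A j @ ?R (k (r - j) - i - 1)) x
          = T j i + T j (Suc i)"
        using iter_int_mult[of "A j @ ?R (k (r - j) - 1 - Suc i)" "z 0" x "S j @ ?R (i - 1)" "z 0"]
        by (simp add: T_def mult.commute add.commute diff_diff_add del: append_assoc)
      then show "(- 1) ^ (i - 1) *
          L (z 0) (replicate p ?w @ bwd r z j) (replicate (p - 1) 1 @ bwd r k j @ [i + 1]) x *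
          L (z 0) (replicate (q - 1) (z 1) @ fwd z (r - j))
            (replicate (q - 1) 1 @ fwd k (r - j - 1) @ [k (r - j) - i]) x
        = (- 1) ^ (i - 1) * (T j i + T j (Suc i))"
        unfolding L_def pre[OF j] suf by (simp add: mult.assoc)
    qed
    also have "\<dots> = T j 1 - (- 1) ^ (k (r - j) - 2) * T j (Suc (k (r - j) - 2))"
      by (rule alternating_sum_telescope)
    \<comment> \<open>The subtraction is exact by \<open>k2\<close>, so the parity is kept.\<close>
    also have "(- 1 :: complex) ^ (k (r - j) - 2) = (- 1) ^ k (r - j)"
      using k2[OF j] by (simp add: uminus_power_if)
    also have "Suc (k (r - j) - 2) = k (r - j) - 1"
      using k2[OF j] by simp
    finally show ?thesis .
  qed

  have cross:
    "L (z 0) (replicate p ?w @ bwd r z j) (replicate (p - 1) 1 @ bwd r k (j + 1)) x *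
      L (z 0) (replicate (q - 1) (z 1) @ fwd z (r - j))
        (replicate (q - 1) 1 @ fwd k (r - j - 1) @ [1]) x
      - L (z 0) (replicate p ?w @ bwd r z (j + 1)) (replicate (p - 1) 1 @ bwd r k (j + 1) @ [1]) x *
      L (z 0) (replicate (q - 1) (z 1) @ fwd z (r - j - 1))
        (replicate (q - 1) 1 @ fwd k (r - j - 1)) x
    = T j (k (r - j) - 1) - T (Suc j) 1" if j: "j < r - 1" for j
  proof -
    have j': "j < r" "Suc j < r"
      using j by simp_all
    \<comment> \<open>The two products are the cuts right and left of \<open>z (r - j)\<close>; both
      contain its own value \<open>?X\<close>, which cancels.\<close>
    let ?X = "glued_int (P j) (z (r - j)) (S j @ ?R (k (r - j) - 1)) x"
    \<comment> \<open>Indices at least 2 ensure that both neighbours of \<open>z (r - j)\<close> are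
      letters \<open>z 0\<close>.\<close>
    have SR: "S j @ ?R (k (r - j) - 1) = (S j @ ?R (k (r - j) - 1 - 1)) @ [z 0]"
      using R_snoc[of "k (r - j) - 1"] k2[OF j'(1)] by simp
    have PR: "P j = (A (Suc j) @ ?R (k (r - Suc j) - 1 - 1)) @ [z 0]"
      using R_snoc[of "k (r - Suc j) - 1"] k2[OF j'(2)] P_Suc[OF j] by simp
    have conv: "iter_int_abs_conv (S j @ ?R (k (r - j) - 1)) x" "iter_int_abs_conv (A j) x"
      "iter_int_abs_conv (S (Suc j)) x" "iter_int_abs_conv (P j) x"
      using assms(11)[OF j] assms(12)[OF j] assms(13)[OF j] assms(14)[OF j]
        suf[of "j + 1" 1] suf'[of j] pre[OF j'(1), of 1]
      by (simp_all add: L_abs_conv_def P_def)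
    have "iter_int (A j) x * iter_int (S j @ ?R (k (r - j) - 1)) x = ?X + T j (k (r - j) - 1)"
      using iter_int_mult[of "P j" "z (r - j)" x "S j @ ?R (k (r - j) - 1 - 1)" "z 0"] conv(1,2)
      unfolding SR[symmetric] A_def[symmetric] by (simp add: T_def)
    moreover have "iter_int (P j) x * iter_int (S (Suc j)) x = T (Suc j) 1 + ?X"
      using iter_int_mult[of "A (Suc j) @ ?R (k (r - Suc j) - 1 - 1)" "z 0" x
          "S j @ ?R (k (r - j) - 1)" "z (r - j)"] conv(3,4)
      unfolding PR[symmetric] S_Suc[symmetric] by (simp add: T_def)
    moreover have "L (z 0) (replicate p ?w @ bwd r z (j + 1))
        (replicate (p - 1) 1 @ bwd r k (j + 1) @ [1]) x = iter_int (S (Suc j)) x"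
      using suf[of "j + 1" 1] by (simp add: L_def)
    moreover have "L (z 0) (replicate (q - 1) (z 1) @ fwd z (r - j))
        (replicate (q - 1) 1 @ fwd k (r - j - 1) @ [1]) x = iter_int (A j) x"
      using pre[OF j'(1), of 1] by (simp add: L_def)
    ultimately show ?thesis
      using suf'[of j] by (simp add: L_def P_def mult.commute)
  qed

  \<comment> \<open>The index \<open>k r - 1\<close> leaves out one \<open>z 0\<close>, the
    rightmost of all, which is the explicit factor in \<open>xi\<close>.\<close>
  have xi_first: "xi (z 0) x (replicate (q - 1) (z 1) @ fwd z r)
      (replicate (q - 1) 1 @ fwd k (r - 1) @ [k r - 1]) ?w p = T 0 1"
    using pre[of 0 "k r - 1"] assms(3)
    by (simp add: xi_def L_def L_word_replicate_one[simplified] T_def glued_int_def S_0 mult_ac)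
  have A_last: "A (r - 1) = replicate q (z 1)"
    using L_word_replicate_one[of "z 0" "q - 1" "z 1"] assms(2,3)
    by (cases q) (simp_all add: A_def P_def fwd_def replicate_append_same)
  \<comment> \<open>Here the explicit factor is the leftmost \<open>z 0\<close>: nothing but
    \<open>q\<close> letters \<open>z 1\<close> precedes it.\<close>
  have xi_second: "xi (z 0) x (replicate p ?w @ bwd r z (r - 1))
      (replicate (p - 1) 1 @ bwd r k (r - 1) @ [k 1 - 1]) (z 1) q = T (r - 1) (k 1 - 1)"
    using suf[of "r - 1" "k 1 - 1"] A_last assms(3)
    by (simp add: xi_def L_def L_word_replicate_one[simplified] T_def glued_int_def)
  have s_0: "s 0 = 1" and s_r: "s r = (- 1) ^ sum_list (fwd k r)"
    by (simp add: s_def bwd_def) (simp add: s_def bwd_full sum_list_rev)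

  have "(\<Sum>j<r. s j * (T j 1 - (- 1) ^ k (r - j) * T j (k (r - j) - 1)))
      + (\<Sum>j<r - 1. s (j + 1) * (T j (k (r - j) - 1) - T (Suc j) 1))
    = T 0 1 - s r * T (r - 1) (k 1 - 1)"
    \<comment> \<open>With \<open>n = r - 1\<close>, \<open>s (Suc j)\<close> absorbs the sign
      \<open>(- 1) ^ k (r - j)\<close>.\<close>
    using block_sum_telescope[of s "\<lambda>j. T j 1" "\<lambda>j. T j (k (r - j) - 1)" "r - 1"] assms(3)
    by (simp add: s_0 s_Suc algebra_simps)
  then show ?thesis
    using inner cross unfolding xi_first xi_second s_r[symmetric] s_def[symmetric]
    by simp
qed

end
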